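(* Let $m\ge 1$ be an integer and let $\omega$ be a modulus of continuity. There is a compact and perfect set $K\subset\mathbb{R}$, a constant $\hat C>0$, and collections $F=(F^k)_{k=0}^m$, $G=(G^k)_{k=0}^m$, and $H=(H^k)_{k=0}^m$ of continuous, real-valued functions on $K$ such that (1) $F$, $G$, and $H$ are Whitney fields of class $C^{m,\omega}$ on $K$; (2) for every $1\le k\le m$ the following holds on $K$: \[ H^k = 2\sum_{i=0}^{k-1}\binom{k-1}{i}\left(F^{k-i}G^i-G^{k-i}F^i\right); \] (3) \[ \left|\frac{A(a,b)}{V_1(a,b)}\right|\le \hat C\,\omega(b-a)\qquad\text{for all } a,b\in K \text{ with } a<b; \] but for every $\alpha\in(\tfrac12,1]$ there is no horizontal curve $\Gamma\in C^{m,\omega^\alpha}(\mathbb{R},\mathbb{R}^3)$ satisfying $\Gamma|_K=(F^0,G^0,H^0)$.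
   Context: A modulus of continuity is a function $\omega\colon[0,\infty]\to[0,\infty]$ which is continuous, increasing, and concave with $\omega(0)=0$ and which is not identically $0$. If $\omega$ is such a function, so is $\omega^\alpha$ for $0<\alpha\le1$, where $\omega^\alpha(t)=(\omega(t))^\alpha$. Given an interval $I\subset\mathbb{R}$ and a modulus of continuity $\omega$, a map $\varphi\colon I\to\mathbb{R}$ is of class $C^{m,\omega}$ if $\varphi$ is $C^m$ and $\sup_{a,b\in I,\,a\ne b}\frac{|D^m\varphi(b)-D^m\varphi(a)|}{\omega(|b-a|)}<\infty$. A map into $\mathbb{R}^3$ is of class $C^{m,\omega}$ if each component is. The first Heisenberg group $\mathbb{H}^1$ is identified with $\mathbb{R}^3$ with coordinates $(x,y,t)$, with vector fields $X=\partial_x+2y\,\partial_t$ and $Y=\partial_y-2x\,\partial_t$. An absolutely continuous curve $\gamma$ in $\mathbb{R}^3$ is horizontal if, at almost every parameter $s$, $\gamma'(s)$ is a linear combination of $X(\gamma(s))$ and $Y(\gamma(s))$. For a collection $F=(F^k)_{k=0}^m$ of continuous real-valued functions on $K$ write $F(x)=F^0(x)$, and for $a\in K$ let $T_a^mF(x)=\sum_{k=0}^m\frac{F^k(a)}{k!}(x-a)^k$, $x\in\mathbb{R}$; similarly $T_a^{m-k}F^k(x)=\sum_{\ell=0}^{m-k}\frac{F^{k+\ell}(a)}{\ell!}(x-a)^\ell$. $F$ is a Whitney field of class $C^{m,\omega}$ on the compact set $K$ if there is a constant $C>0$ with $|F^k(b)-T_a^{m-k}F^k(b)|\le C\,\omega(|b-a|)\,|b-a|^{m-k}$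 for every $0\le k\le m$ and $a,b\in K$. For $a,b\in K$ with $a<b$, the area discrepancy is \[A(a,b)=H(b)-H(a)-2\int_a^b\big((T_a^mF)'(T_a^mG)-(T_a^mG)'(T_a^mF)\big)+2F(a)\big(G(b)-T_a^mG(b)\big)-2G(a)\big(F(b)-T_a^mF(b)\big),\] and \[V_1(a,b)=(b-a)^{2m}+(b-a)^m\int_a^b\big(|(T_a^mF)'|+|(T_a^mG)'|\big).\] *)

theory Defs
  imports "HOL-Analysis.Analysis"
begin

text \<open>
  Moduli of continuity live on the extended half-line, i.e. on \<^typ>\<open>ennreal\<close>, with its order
  topology. In the concavity condition the convention \<open>0 \<cdot> \<infinity> = 0\<close> of \<^typ>\<open>ennreal\<close> is in force.
  ``Increasing'' is read in the weak sense.
\<close>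

definition modulus_of_continuity :: "(ennreal \<Rightarrow> ennreal) \<Rightarrow> bool" where
  "modulus_of_continuity \<omega> \<longleftrightarrow>
     continuous_on UNIV \<omega> \<and> mono \<omega> \<and>
     (\<forall>s t. \<forall>u\<in>{0..1::real}.
        ennreal (1 - u) * \<omega> s + ennreal u * \<omega> t \<le> \<omega> (ennreal (1 - u) * s + ennreal u * t)) \<and>
     \<omega> 0 = 0 \<and> (\<exists>t. \<omega> t \<noteq> 0)"

definition modulus_power :: "(ennreal \<Rightarrow> ennreal) \<Rightarrow> real \<Rightarrow> ennreal \<Rightarrow> ennreal" where
  "modulus_power \<omega> \<alpha> t = (if \<omega> t = top then top else ennreal (enn2real (\<omega> t) powr \<alpha>))"

text \<open>
  The witness \<open>D k\<close> is the \<open>k\<close>-th derivative on \<open>I\<close> (one-sided at endpoints belonging to \<open>I\<close>);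
  on a nondegenerate interval it is uniquely determined.
\<close>

definition C_class :: "nat \<Rightarrow> (ennreal \<Rightarrow> ennreal) \<Rightarrow> real set \<Rightarrow> (real \<Rightarrow> real) \<Rightarrow> bool" where
  "C_class m \<omega> I \<phi> \<longleftrightarrow>
     (\<exists>D :: nat \<Rightarrow> real \<Rightarrow> real.
        (\<forall>x\<in>I. D 0 x = \<phi> x) \<and>
        (\<forall>k<m. \<forall>x\<in>I. (D k has_real_derivative D (Suc k) x) (at x within I)) \<and>
        continuous_on I (D m) \<and>
        (SUP (a, b)\<in>{(a, b). a \<in> I \<and> b \<in> I \<and> a \<noteq> b}.
           ennreal \<bar>D m b - D m a\<bar> / \<omega> (ennreal \<bar>b - a\<bar>)) < top)"

definition C_class_curve ::
    "nat \<Rightarrow> (ennreal \<Rightarrow> ennreal) \<Rightarrow> real set \<Rightarrow> (real \<Rightarrow> real^3) \<Rightarrow> bool" where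
  "C_class_curve m \<omega> I \<gamma> \<longleftrightarrow> (\<forall>i. C_class m \<omega> I (\<lambda>s. \<gamma> s $ i))"

definition heis_X :: "real^3 \<Rightarrow> real^3" where
  "heis_X p = vector [1, 0, 2 * p $ 2]"

definition heis_Y :: "real^3 \<Rightarrow> real^3" where
  "heis_Y p = vector [0, 1, - 2 * p $ 1]"

text \<open>
  The elements of \<open>\<D>\<close> are finitely many nonoverlapping compact intervals in \<open>S\<close>.
\<close>

definition absolutely_continuous_on :: "real set \<Rightarrow> (real \<Rightarrow> 'a::real_normed_vector) \<Rightarrow> bool" where
  "absolutely_continuous_on S \<gamma> \<longleftrightarrow>
     (\<forall>\<epsilon>>0. \<exists>\<delta>>0. \<forall>\<D>. \<D> division_of \<Union>\<D> \<and> \<Union>\<D> \<subseteq> S \<and> (\<Sum>J\<in>\<D>. Sup J - Inf J) < \<delta> \<longrightarrow>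
        (\<Sum>J\<in>\<D>. norm (\<gamma> (Sup J) - \<gamma> (Inf J))) < \<epsilon>)"

text \<open>
  For a curve defined on the whole line, absolute continuity is required on every compact interval.
\<close>

definition horizontal_curve :: "(real \<Rightarrow> real^3) \<Rightarrow> bool" where
  "horizontal_curve \<gamma> \<longleftrightarrow>
     (\<forall>c d. absolutely_continuous_on {c..d} \<gamma>) \<and>
     (AE s in lebesgue. \<exists>p q. (\<gamma> has_vector_derivative
        p *\<^sub>R heis_X (\<gamma> s) + q *\<^sub>R heis_Y (\<gamma> s)) (at s))"

definition perfect :: "real set \<Rightarrow> bool" where
  "perfect K \<longleftrightarrow> {x. x islimpt K} = K"

text \<open>
  A collection \<open>(F\<^sup>k)\<close> with \<open>0 \<le> k \<le> m\<close> is a function \<^typ>\<open>nat \<Rightarrow> real \<Rightarrow> real\<close> of which only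
  the values \<open>F k x\<close> with \<open>k \<le> m\<close> and \<open>x \<in> K\<close> matter. The polynomial
  \<open>T\<^sub>a\<^sup>m\<^sup>-\<^sup>k F\<^sup>k\<close> is the Taylor polynomial of the shifted collection \<open>\<lambda>l. F (k + l)\<close>.
\<close>

definition taylor :: "nat \<Rightarrow> (nat \<Rightarrow> real \<Rightarrow> real) \<Rightarrow> real \<Rightarrow> real \<Rightarrow> real" where
  "taylor m F a x = (\<Sum>k\<le>m. F k a / fact k * (x - a) ^ k)"

definition whitney_field ::
    "nat \<Rightarrow> (ennreal \<Rightarrow> ennreal) \<Rightarrow> real set \<Rightarrow> (nat \<Rightarrow> real \<Rightarrow> real) \<Rightarrow> bool" where
  "whitney_field m \<omega> K F \<longleftrightarrow>
     (\<exists>C>0. \<forall>k\<le>m. \<forall>a\<in>K. \<forall>b\<in>K.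
        ennreal \<bar>F k b - taylor (m - k) (\<lambda>l. F (k + l)) a b\<bar>
          \<le> ennreal C * \<omega> (ennreal \<bar>b - a\<bar>) * ennreal (\<bar>b - a\<bar> ^ (m - k)))"

definition area_discrepancy ::
    "nat \<Rightarrow> (nat \<Rightarrow> real \<Rightarrow> real) \<Rightarrow> (nat \<Rightarrow> real \<Rightarrow> real) \<Rightarrow> (nat \<Rightarrow> real \<Rightarrow> real) \<Rightarrow>
     real \<Rightarrow> real \<Rightarrow> real" where
  "area_discrepancy m F G H a b =
     H 0 b - H 0 a
     - 2 * integral {a..b} (\<lambda>x. deriv (taylor m F a) x * taylor m G a x
                              - deriv (taylor m G a) x * taylor m F a x)
     + 2 * F 0 a * (G 0 b - taylor m G a b)
     - 2 * G 0 a * (F 0 b - taylor m F a b)"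

definition velocity1 ::
    "nat \<Rightarrow> (nat \<Rightarrow> real \<Rightarrow> real) \<Rightarrow> (nat \<Rightarrow> real \<Rightarrow> real) \<Rightarrow> real \<Rightarrow> real \<Rightarrow> real" where
  "velocity1 m F G a b =
     (b - a) ^ (2 * m)
     + (b - a) ^ m * integral {a..b} (\<lambda>x. \<bar>deriv (taylor m F a) x\<bar> + \<bar>deriv (taylor m G a) x\<bar>)"

end

theory Submission
  imports Defs
begin

text \<open>
  The example exploits that a vanishing horizontal projection gains a power of the modulus. Let
  \<open>F\<close> and \<open>G\<close> be zero fields, so that only the height \<open>H\<^sup>0\<close> is free and the algebraic relations
  amount to \<open>H\<^sup>k = 0\<close> for \<open>1 \<le> k \<le> m\<close>. Then \<open>A(a,b) = H\<^sup>0(b) - H\<^sup>0(a)\<close> and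
  \<open>V\<^sub>1(a,b) = (b - a)\<^sup>2\<^sup>m\<close>, and the area hypothesis asks exactly that \<open>H\<^sup>0\<close> vary by at most a constant
  times \<open>\<omega>(b - a) (b - a)\<^sup>2\<^sup>m\<close>. This forces \<open>H\<^sup>0\<close> to be constant on intervals, but \<open>K\<close> may have gaps,
  across which \<open>H\<^sup>0\<close> may jump by that amount.

  Let \<open>K\<close> consist of \<open>0\<close> and the intervals \<open>[2\<^sup>-\<^sup>n, 3/2 \<cdot> 2\<^sup>-\<^sup>n]\<close>, and let \<open>H\<^sup>0\<close> have the value
  \<open>\<omega>(s) s\<^sup>2\<^sup>m\<close> with \<open>s = 2\<^sup>-\<^sup>n\<close> on the interval starting at \<open>s\<close>, and the value \<open>0\<close> at \<open>0\<close>. The gap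
  just below the interval starting at \<open>s\<close> has length \<open>s/4\<close>, so concavity of \<open>\<omega>\<close> gives the
  upper bound on the variation (\<open>height_gauge_dyadic_floor_diff\<close>). That bound also makes \<open>H\<close> a Whitney
  field, as \<open>2m \<ge> m\<close> and \<open>K\<close> is bounded.

  Suppose a horizontal curve \<open>(f, g, h)\<close> of class \<open>C\<^sup>m\<close> with modulus \<open>\<omega>\<^sup>\<alpha>\<close> extends these data. The
  intervals in \<open>K\<close> accumulate at \<open>0\<close>, so all derivatives of \<open>f\<close> and \<open>g\<close> up to order \<open>m\<close> vanish there.
  Hence on \<open>[0, b]\<close> both \<open>|f|\<close> and \<open>|g|\<close> are at most a constant times \<open>\<omega>(b)\<^sup>\<alpha> b\<^sup>m\<close>, with one power
  of \<open>b\<close> less for \<open>|f'|\<close> and \<open>|g'|\<close>. Horizontality means \<open>h' = 2 (f' g - g' f)\<close>, in which the two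
  bounds multiply: \<open>|h(b) - h(0)| \<le> C \<omega>(b)\<^sup>2\<^sup>\<alpha> b\<^sup>2\<^sup>m\<close> (\<open>horizontal_flat_height_bound\<close>). At
  \<open>b = 2\<^sup>-\<^sup>n\<close> the left side is \<open>\<omega>(b) b\<^sup>2\<^sup>m\<close>, so \<open>1 \<le> C \<omega>(b)\<^sup>2\<^sup>\<alpha>\<^sup>-\<^sup>1\<close> for all these \<open>b\<close>. For
  \<open>\<alpha> > 1/2\<close> this contradicts \<open>\<omega>(b) \<longlonglongrightarrow> 0\<close>.
\<close>

section \<open>Moduli of continuity on the real half-line\<close>

definition real_modulus :: "(ennreal \<Rightarrow> ennreal) \<Rightarrow> real \<Rightarrow> real" where
  "real_modulus \<omega> t = enn2real (\<omega> (ennreal t))"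

lemma modulus_tendsto:
  assumes "modulus_of_continuity \<omega>" and "(f \<longlongrightarrow> l) net"
  shows "((\<lambda>x. \<omega> (f x)) \<longlongrightarrow> \<omega> l) net"
proof -
  have "isCont \<omega> l"
    using assms(1) by (simp add: modulus_of_continuity_def continuous_on_eq_continuous_at)
  then show ?thesis using assms(2) by (rule isCont_tendsto_compose)
qed

lemma modulus_concave_at_0:
  assumes "modulus_of_continuity \<omega>" "0 \<le> u" "u \<le> 1"
  shows "ennreal u * \<omega> t \<le> \<omega> (ennreal u * t)"
proof -
  have "ennreal (1 - u) * \<omega> 0 + ennreal u * \<omega> t \<le> \<omega> (ennreal (1 - u) * 0 + ennreal u * t)"
    using assms unfolding modulus_of_continuity_def by (metis atLeastAtMost_iff)
  moreover have "\<omega> 0 = 0" using assms(1) by (simp add: modulus_of_continuity_def)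
  ultimately show ?thesis by simp
qed

text \<open>
  An infinite value at a finite \<open>t\<close> would spread by concavity to every \<open>u t\<close> with \<open>0 < u \<le> 1\<close>, and
  so contradict continuity at \<open>0\<close>. All estimates can therefore be made with real numbers.
\<close>

lemma modulus_finite:
  assumes \<omega>: "modulus_of_continuity \<omega>"
  shows "\<omega> (ennreal t) \<noteq> top"
proof
  assume top: "\<omega> (ennreal t) = top"
  have "\<omega> (ennreal (inverse (real (Suc n))) * ennreal t) = top" for n
    using modulus_concave_at_0[OF \<omega>, of "inverse (real (Suc n))" "ennreal t"] top
    by (simp add: ennreal_mult_top top_unique field_simps)
  moreover have "(\<lambda>n. ennreal (inverse (real (Suc n))) * ennreal t) \<longlonglongrightarrow> ennreal 0 * ennreal t"
    by (intro tendsto_intros ennreal_tendsto_cmult tendsto_mult_ennreal tendsto_ennrealI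
        LIMSEQ_inverse_real_of_nat) auto
  from modulus_tendsto[OF \<omega> this]
  have "(\<lambda>n. \<omega> (ennreal (inverse (real (Suc n))) * ennreal t)) \<longlonglongrightarrow> 0"
    using \<omega> by (simp add: modulus_of_continuity_def)
  ultimately have "(\<lambda>n::nat. top :: ennreal) \<longlonglongrightarrow> 0" by simp
  then show False by (simp add: LIMSEQ_const_iff)
qed

lemma ennreal_real_modulus:
  assumes "modulus_of_continuity \<omega>"
  shows "\<omega> (ennreal t) = ennreal (real_modulus \<omega> t)"
  using modulus_finite[OF assms, of t] by (simp add: real_modulus_def less_top)

lemma real_modulus_nonneg [simp]: "0 \<le> real_modulus \<omega> t"
  by (simp add: real_modulus_def)

lemma real_modulus_mono:
  assumes "modulus_of_continuity \<omega>" "s \<le> t"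
  shows "real_modulus \<omega> s \<le> real_modulus \<omega> t"
proof -
  have "\<omega> (ennreal s) \<le> \<omega> (ennreal t)"
    using assms monoD[of \<omega> "ennreal s" "ennreal t"] ennreal_leI[of s t]
    by (simp add: modulus_of_continuity_def)
  then show ?thesis
    by (simp add: ennreal_real_modulus[OF assms(1)])
qed

lemma real_modulus_scale:
  assumes "modulus_of_continuity \<omega>" "0 \<le> u" "u \<le> 1"
  shows "u * real_modulus \<omega> t \<le> real_modulus \<omega> (u * t)"
  using modulus_concave_at_0[OF assms, of "ennreal t"] assms(2)
  by (simp add: ennreal_real_modulus[OF assms(1)] flip: ennreal_mult' ennreal_mult'')

text \<open>
  A zero at some \<open>t > 0\<close> would spread to all larger arguments by concavity, to all smaller ones by
  monotonicity, and the modulus would be identically zero. Dividing by \<open>\<omega>(b)\<close> at the end of the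
  proof relies on this.
\<close>

lemma real_modulus_pos:
  assumes \<omega>: "modulus_of_continuity \<omega>" and "0 < t"
  shows "0 < real_modulus \<omega> t"
proof (rule ccontr)
  assume "\<not> 0 < real_modulus \<omega> t"
  then have zero: "real_modulus \<omega> t = 0"
    using real_modulus_nonneg[of \<omega> t] by linarith
  have fin: "real_modulus \<omega> s = 0" for s
  proof (cases "s \<le> t")
    case True
    then show ?thesis
      using real_modulus_mono[OF \<omega>, of s t] real_modulus_nonneg[of \<omega> s] zero by linarith
  next
    case False
    then have "t / s * real_modulus \<omega> s \<le> real_modulus \<omega> (t / s * s)"
      using \<open>0 < t\<close> by (intro real_modulus_scale[OF \<omega>]) auto
    then have "t / s * real_modulus \<omega> s \<le> 0"
      using False \<open>0 < t\<close> zero by simp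
    moreover have "0 < t / s" using False \<open>0 < t\<close> by simp
    ultimately show ?thesis
      using real_modulus_nonneg[of \<omega> s] by (metis mult_pos_pos not_less order_le_less)
  qed
  \<comment> \<open>Vanishing at every finite argument extends to infinity by continuity.\<close>
  have "(\<lambda>n. \<omega> (of_nat n)) \<longlonglongrightarrow> \<omega> top"
    by (intro modulus_tendsto[OF \<omega>] of_nat_tendsto_top_ennreal)
  moreover have "\<omega> (of_nat n) = 0" for n
    using ennreal_real_modulus[OF \<omega>, of "real n"] fin by (simp add: ennreal_of_nat_eq_real_of_nat)
  ultimately have "\<omega> top = 0" by (simp add: LIMSEQ_const_iff)
  then have "\<omega> s = 0" for s
    using ennreal_real_modulus[OF \<omega>] fin by (cases s) auto
  then show False using \<omega> by (simp add: modulus_of_continuity_def)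
qed

lemma real_modulus_tendsto_0:
  assumes \<omega>: "modulus_of_continuity \<omega>" and "X \<longlonglongrightarrow> 0"
  shows "(\<lambda>n. real_modulus \<omega> (X n)) \<longlonglongrightarrow> 0"
proof -
  have "(\<lambda>n. ennreal (real_modulus \<omega> (X n))) \<longlonglongrightarrow> ennreal 0"
    using modulus_tendsto[OF \<omega> tendsto_ennrealI[OF assms(2)]] \<omega>
    by (simp add: ennreal_real_modulus modulus_of_continuity_def)
  then show ?thesis by (subst (asm) tendsto_ennreal_iff) auto
qed

lemma modulus_power_real:
  assumes "modulus_of_continuity \<omega>"
  shows "modulus_power \<omega> \<alpha> (ennreal t) = ennreal (real_modulus \<omega> t powr \<alpha>)"
  using modulus_finite[OF assms] by (simp add: modulus_power_def real_modulus_def)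

section \<open>Horizontal curves with flat projection\<close>

text \<open>
  Turns the finite supremum of quotients in \<^typ>\<open>ennreal\<close> into an inequality between real numbers;
  this needs the quotients to have positive finite denominators.
\<close>

lemma C_class_modulus_bound:
  assumes \<omega>: "modulus_of_continuity \<omega>" and "C_class m (modulus_power \<omega> \<alpha>) UNIV \<phi>"
  shows "\<exists>D C. 0 \<le> C \<and> D 0 = \<phi> \<and>
    (\<forall>k x. k < m \<longrightarrow> (D k has_real_derivative D (Suc k) x) (at x)) \<and>
    (\<forall>k\<le>m. continuous_on UNIV (D k)) \<and>
    (\<forall>x y. x < y \<longrightarrow> \<bar>D m y - D m x\<bar> \<le> C * real_modulus \<omega> (y - x) powr \<alpha>)"
proof -
  obtain D where D: "\<And>x. D 0 x = \<phi> x"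
    "\<And>k x. k < m \<Longrightarrow> (D k has_real_derivative D (Suc k) x) (at x)"
    "continuous_on UNIV (D m)"
    and sup: "(SUP (a, b)\<in>{(a, b). a \<in> UNIV \<and> b \<in> UNIV \<and> a \<noteq> b}.
       ennreal \<bar>D m b - D m a\<bar> / modulus_power \<omega> \<alpha> (ennreal \<bar>b - a\<bar>)) < top" (is "?S < top")
    using assms(2) unfolding C_class_def by auto
  have cont: "continuous_on UNIV (D k)" if "k \<le> m" for k
  proof (cases "k = m")
    case False
    then show ?thesis using D(2)[of k] that
      by (auto intro!: continuous_at_imp_continuous_on intro: DERIV_isCont)
  qed (use D(3) in simp)
  have "\<bar>D m y - D m x\<bar> \<le> enn2real ?S * real_modulus \<omega> (y - x) powr \<alpha>" if "x < y" for x y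
  proof -
    let ?w = "real_modulus \<omega> (y - x) powr \<alpha>"
    have w: "0 < ?w" using real_modulus_pos[OF \<omega>, of "y - x"] that by simp
    have "ennreal \<bar>D m y - D m x\<bar> / modulus_power \<omega> \<alpha> (ennreal \<bar>y - x\<bar>) \<le> ?S"
      using that by (intro SUP_upper2[of "(x, y)"]) auto
    also have "?S = ennreal (enn2real ?S)" using sup by simp
    finally have "ennreal (\<bar>D m y - D m x\<bar> / ?w) \<le> ennreal (enn2real ?S)"
      using that w by (simp add: modulus_power_real[OF \<omega>] divide_ennreal)
    then have "\<bar>D m y - D m x\<bar> / ?w \<le> enn2real ?S"
      by (subst (asm) ennreal_le_iff) auto
    then show ?thesis using w by (simp add: pos_divide_le_eq)
  qed
  then show ?thesis
    using D cont by (intro exI[of _ D] exI[of _ "enn2real ?S"]) auto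
qed

text \<open>
  Differentiating a function that vanishes on an open set stays within the functions vanishing on
  that set, and continuity carries the zeros to the closure. This is what makes the horizontal
  components flat at the accumulation point \<open>0\<close>.
\<close>

lemma derivatives_vanish_on_closure:
  fixes D :: "nat \<Rightarrow> real \<Rightarrow> real"
  assumes der: "\<And>k x. k < m \<Longrightarrow> (D k has_real_derivative D (Suc k) x) (at x)"
    and cont: "\<And>k. k \<le> m \<Longrightarrow> continuous_on UNIV (D k)"
    and "open U" and zero: "\<And>x. x \<in> U \<Longrightarrow> D 0 x = 0"
    and "k \<le> m" "a \<in> closure U"
  shows "D k a = 0"
proof -
  have "D k x = 0" if "x \<in> U" for x
    using \<open>k \<le> m\<close> that
  proof (induction k arbitrary: x)
    case (Suc k)
    have "(D k has_real_derivative 0) (at x)"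
    proof (rule has_field_derivative_transform_within_open[OF DERIV_const \<open>open U\<close> \<open>x \<in> U\<close>])
      show "0 = D k y" if "y \<in> U" for y using Suc.IH[of y] Suc.prems(1) that by simp
    qed
    moreover have "(D k has_real_derivative D (Suc k) x) (at x)"
      using Suc.prems by (intro der) simp
    ultimately show ?case by (metis DERIV_unique)
  qed (use zero in simp)
  moreover have "continuous_on (closure U) (D k)"
    by (rule continuous_on_subset[OF cont[OF \<open>k \<le> m\<close>]]) simp
  ultimately show ?thesis
    using \<open>a \<in> closure U\<close> by (intro continuous_constant_on_closure[of U "D k" 0 a])
qed

text \<open>
  Each step down from the derivative of order \<open>m\<close> applies the mean value inequality on \<open>[a, x]\<close> to a
  function vanishing at \<open>a\<close>, and so gains one factor \<open>b - a\<close>.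
\<close>

lemma flat_derivative_bound:
  fixes D :: "nat \<Rightarrow> real \<Rightarrow> real"
  assumes der: "\<And>k x. k < m \<Longrightarrow> (D k has_real_derivative D (Suc k) x) (at x)"
    and zero: "\<And>k. k \<le> m \<Longrightarrow> D k a = 0"
    and top: "\<And>x. a \<le> x \<Longrightarrow> x \<le> b \<Longrightarrow> \<bar>D m x\<bar> \<le> M"
    and "j \<le> m" "a \<le> x" "x \<le> b"
  shows "\<bar>D (m - j) x\<bar> \<le> M * (b - a) ^ j"
  using assms(4-)
proof (induction j arbitrary: x)
  case 0
  then show ?case using top by simp
next
  case (Suc j)
  have idx: "Suc (m - Suc j) = m - j" "m - Suc j < m" using Suc.prems by auto
  have "norm (D (m - Suc j) x - D (m - Suc j) a) \<le> M * (b - a) ^ j * norm (x - a)"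
  proof (rule field_differentiable_bound[of "{a..b}"])
    fix z assume "z \<in> {a..b}"
    then show "(D (m - Suc j) has_field_derivative D (m - j) z) (at z within {a..b})"
      using der[OF idx(2), of z] idx(1) by (simp add: has_field_derivative_at_within)
    show "norm (D (m - j) z) \<le> M * (b - a) ^ j"
      using Suc \<open>z \<in> {a..b}\<close> by simp
  qed (use Suc.prems in auto)
  also have "\<dots> \<le> M * (b - a) ^ j * (b - a)"
  proof (intro mult_left_mono)
    have "0 \<le> M" using top[of a] Suc.prems by fastforce
    then show "0 \<le> M * (b - a) ^ j" using Suc.prems by simp
  qed (use Suc.prems in auto)
  finally show ?case using zero[of "m - Suc j"] by (simp add: mult_ac)
qed

text \<open>
  Comparing the first two components of the horizontality condition identifies the coefficients of
  \<open>X\<close> and \<open>Y\<close> as \<open>f'\<close> and \<open>g'\<close>; the third component is then the contact equation. It holds almost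
  everywhere, hence everywhere, because for a curve of class \<open>C\<^sup>1\<close> it describes a closed set of
  parameters and a closed set of full measure is the whole line.
\<close>

lemma horizontal_imp_contact_equation:
  fixes f' g' h' :: "real \<Rightarrow> real"
  assumes hor: "horizontal_curve \<Gamma>"
    and f: "\<And>s. ((\<lambda>s. \<Gamma> s $ 1) has_real_derivative f' s) (at s)" and "continuous_on UNIV f'"
    and g: "\<And>s. ((\<lambda>s. \<Gamma> s $ 2) has_real_derivative g' s) (at s)" and "continuous_on UNIV g'"
    and h: "\<And>s. ((\<lambda>s. \<Gamma> s $ 3) has_real_derivative h' s) (at s)" and "continuous_on UNIV h'"
  shows "h' s = 2 * (f' s * \<Gamma> s $ 2 - g' s * \<Gamma> s $ 1)"
proof -
  let ?E = "{s. h' s = 2 * (f' s * \<Gamma> s $ 2 - g' s * \<Gamma> s $ 1)}"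
  have cont: "continuous_on UNIV (\<lambda>s. \<Gamma> s $ 1)" "continuous_on UNIV (\<lambda>s. \<Gamma> s $ 2)"
    using f g by (auto intro!: continuous_at_imp_continuous_on intro: DERIV_isCont)
  have "closed ?E"
    by (intro closed_Collect_eq continuous_intros cont assms)
  moreover have "AE s in lebesgue. s \<in> ?E"
  proof (rule AE_mp)
    show "AE s in lebesgue. \<exists>p q. (\<Gamma> has_vector_derivative
        p *\<^sub>R heis_X (\<Gamma> s) + q *\<^sub>R heis_Y (\<Gamma> s)) (at s)"
      using hor by (simp add: horizontal_curve_def)
  next
    show "AE s in lebesgue. (\<exists>p q. (\<Gamma> has_vector_derivative
        p *\<^sub>R heis_X (\<Gamma> s) + q *\<^sub>R heis_Y (\<Gamma> s)) (at s)) \<longrightarrow> s \<in> ?E"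
    proof (intro AE_I2 impI, elim exE)
      fix s p q
      assume v: "(\<Gamma> has_vector_derivative p *\<^sub>R heis_X (\<Gamma> s) + q *\<^sub>R heis_Y (\<Gamma> s)) (at s)"
      have comp: "((\<lambda>s. \<Gamma> s $ i) has_real_derivative
          (p *\<^sub>R heis_X (\<Gamma> s) + q *\<^sub>R heis_Y (\<Gamma> s)) $ i) (at s)" for i
        using bounded_linear.has_vector_derivative[OF bounded_linear_vec_nth v, of i]
        by (simp add: has_real_derivative_iff_has_vector_derivative)
      have "f' s = p"
        using DERIV_unique[OF f comp[of 1]] by (simp add: heis_X_def heis_Y_def vector_3)
      moreover have "g' s = q"
        using DERIV_unique[OF g comp[of 2]] by (simp add: heis_X_def heis_Y_def vector_3)
      moreover have "h' s = p * (2 * \<Gamma> s $ 2) + q * (- 2 * \<Gamma> s $ 1)"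
        using DERIV_unique[OF h comp[of 3]] by (simp add: heis_X_def heis_Y_def vector_3)
      ultimately show "s \<in> ?E" by (simp add: algebra_simps)
    qed
  qed
  ultimately have "s \<in> ?E" by (rule mem_closed_if_AE_lebesgue)
  then show ?thesis by simp
qed

text \<open>
  The height grows by the area swept by the projection, which is quadratic in it. Since the projection
  is of size \<open>\<omega>(b - a)\<^sup>\<alpha> (b - a)\<^sup>m\<close>, the modulus enters with exponent \<open>2 \<alpha>\<close> instead of \<open>\<alpha>\<close>; this
  doubling is responsible for the threshold \<open>\<alpha> = 1/2\<close>.
\<close>

lemma horizontal_flat_height_bound:
  assumes \<omega>: "modulus_of_continuity \<omega>" and "1 \<le> m" and "0 \<le> \<alpha>"
    and hor: "horizontal_curve \<Gamma>"
    and cls: "C_class_curve m (modulus_power \<omega> \<alpha>) UNIV \<Gamma>"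
    and "open U" and zero: "\<And>x. x \<in> U \<Longrightarrow> \<Gamma> x $ 1 = 0 \<and> \<Gamma> x $ 2 = 0"
    and "a \<in> closure U"
  obtains C where "0 \<le> C" "\<And>b. a < b \<Longrightarrow>
    \<bar>\<Gamma> b $ 3 - \<Gamma> a $ 3\<bar> \<le> C * real_modulus \<omega> (b - a) powr (2 * \<alpha>) * (b - a) ^ (2 * m)"
proof -
  have cls': "C_class m (modulus_power \<omega> \<alpha>) UNIV (\<lambda>s. \<Gamma> s $ i)" for i
    using cls by (simp add: C_class_curve_def)
  obtain Df Cf where Df: "0 \<le> Cf" "Df 0 = (\<lambda>s. \<Gamma> s $ 1)"
    "\<forall>k x. k < m \<longrightarrow> (Df k has_real_derivative Df (Suc k) x) (at x)"
    "\<forall>k\<le>m. continuous_on UNIV (Df k)"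
    "\<forall>x y. x < y \<longrightarrow> \<bar>Df m y - Df m x\<bar> \<le> Cf * real_modulus \<omega> (y - x) powr \<alpha>"
    using C_class_modulus_bound[OF \<omega> cls'[of 1]] by blast
  note Df = Df[rule_format]
  obtain Dg Cg where Dg: "0 \<le> Cg" "Dg 0 = (\<lambda>s. \<Gamma> s $ 2)"
    "\<forall>k x. k < m \<longrightarrow> (Dg k has_real_derivative Dg (Suc k) x) (at x)"
    "\<forall>k\<le>m. continuous_on UNIV (Dg k)"
    "\<forall>x y. x < y \<longrightarrow> \<bar>Dg m y - Dg m x\<bar> \<le> Cg * real_modulus \<omega> (y - x) powr \<alpha>"
    using C_class_modulus_bound[OF \<omega> cls'[of 2]] by blast
  note Dg = Dg[rule_format]
  obtain Dh Ch where Dh: "0 \<le> Ch" "Dh 0 = (\<lambda>s. \<Gamma> s $ 3)"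
    "\<forall>k x. k < m \<longrightarrow> (Dh k has_real_derivative Dh (Suc k) x) (at x)"
    "\<forall>k\<le>m. continuous_on UNIV (Dh k)"
    "\<forall>x y. x < y \<longrightarrow> \<bar>Dh m y - Dh m x\<bar> \<le> Ch * real_modulus \<omega> (y - x) powr \<alpha>"
    using C_class_modulus_bound[OF \<omega> cls'[of 3]] by blast
  note Dh = Dh[rule_format]
  have Df0: "Df k a = 0" if "k \<le> m" for k
    by (rule derivatives_vanish_on_closure[where D = Df and m = m, OF Df(3,4) \<open>open U\<close> _ that \<open>a \<in> closure U\<close>])
       (simp_all add: Df(2) zero)
  have Dg0: "Dg k a = 0" if "k \<le> m" for k
    by (rule derivatives_vanish_on_closure[where D = Dg and m = m, OF Dg(3,4) \<open>open U\<close> _ that \<open>a \<in> closure U\<close>])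
       (simp_all add: Dg(2) zero)
  have contact: "Dh 1 s = 2 * (Df 1 s * Dg 0 s - Dg 1 s * Df 0 s)" for s
    using horizontal_imp_contact_equation[OF hor, of "Df 1" "Dg 1" "Dh 1" s]
      Df(2) Df(3,4)[of 0] Df(4)[of 1] Dg(2) Dg(3,4)[of 0] Dg(4)[of 1] Dh(2) Dh(3,4)[of 0] Dh(4)[of 1]
      \<open>1 \<le> m\<close> by simp
  show ?thesis
  proof (rule that)
    show "0 \<le> 4 * Cf * Cg" using Df(1) Dg(1) by simp
    fix b assume "a < b"
    define w where "w = real_modulus \<omega> (b - a) powr \<alpha>"
    define d where "d = b - a"
    have wd: "0 \<le> w" "0 < d" using \<open>a < b\<close> by (auto simp: w_def d_def)
    have top_bound: "\<bar>D m x\<bar> \<le> C * w"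
      if "D m a = (0::real)" "0 \<le> C"
        "\<And>x y. x < y \<Longrightarrow> \<bar>D m y - D m x\<bar> \<le> C * real_modulus \<omega> (y - x) powr \<alpha>"
        "a \<le> x" "x \<le> b" for D :: "nat \<Rightarrow> real \<Rightarrow> real" and C x
    proof (cases "x = a")
      case False
      have "\<bar>D m x - D m a\<bar> \<le> C * real_modulus \<omega> (x - a) powr \<alpha>"
        using that(3)[of a x] False that(1,4) by simp
      also have "\<dots> \<le> C * w"
        unfolding w_def using that \<open>0 \<le> \<alpha>\<close>
        by (intro mult_left_mono powr_mono2 real_modulus_mono[OF \<omega>]) auto
      finally show ?thesis using that by simp
    qed (use that wd in simp)
    have fb: "\<bar>Df (m - j) x\<bar> \<le> Cf * w * d ^ j" if "j \<le> m" "a \<le> x" "x \<le> b" for j x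
      unfolding d_def
      using top_bound[where D = Df, OF Df0 Df(1,5)] that
      by (intro flat_derivative_bound[where D = Df and m = m, OF Df(3) Df0]) auto
    have gb: "\<bar>Dg (m - j) x\<bar> \<le> Cg * w * d ^ j" if "j \<le> m" "a \<le> x" "x \<le> b" for j x
      unfolding d_def
      using top_bound[where D = Dg, OF Dg0 Dg(1,5)] that
      by (intro flat_derivative_bound[where D = Dg and m = m, OF Dg(3) Dg0]) auto
    have hb: "\<bar>Dh 1 x\<bar> \<le> 4 * Cf * Cg * w\<^sup>2 * d ^ (2 * m - 1)" if "a \<le> x" "x \<le> b" for x
    proof -
      have abs_diff: "\<bar>2 * (u - v)\<bar> \<le> 4 * p" if "\<bar>u\<bar> \<le> p" "\<bar>v\<bar> \<le> p" for u v p :: real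
        using that by (simp add: abs_le_iff)
      have "\<bar>Df 1 x * Dg 0 x\<bar> \<le> (Cf * w * d ^ (m - 1)) * (Cg * w * d ^ m)"
        unfolding abs_mult using fb[of "m - 1" x] gb[of m x] that \<open>1 \<le> m\<close> wd Df(1) Dg(1)
        by (intro mult_mono) auto
      moreover have "\<bar>Dg 1 x * Df 0 x\<bar> \<le> (Cg * w * d ^ (m - 1)) * (Cf * w * d ^ m)"
        unfolding abs_mult using gb[of "m - 1" x] fb[of m x] that \<open>1 \<le> m\<close> wd Df(1) Dg(1)
        by (intro mult_mono) auto
      moreover have "d ^ (m - 1) * d ^ m = d ^ (2 * m - 1)"
        using \<open>1 \<le> m\<close> by (simp flip: power_add add: mult_2)
      then have "(Cf * w * d ^ (m - 1)) * (Cg * w * d ^ m) = Cf * Cg * w\<^sup>2 * d ^ (2 * m - 1)"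
        "(Cg * w * d ^ (m - 1)) * (Cf * w * d ^ m) = Cf * Cg * w\<^sup>2 * d ^ (2 * m - 1)"
        by (simp_all add: power2_eq_square mult_ac)
      ultimately have "\<bar>Df 1 x * Dg 0 x\<bar> \<le> Cf * Cg * w\<^sup>2 * d ^ (2 * m - 1)"
        "\<bar>Dg 1 x * Df 0 x\<bar> \<le> Cf * Cg * w\<^sup>2 * d ^ (2 * m - 1)" by (simp_all only:)
      then have "\<bar>2 * (Df 1 x * Dg 0 x - Dg 1 x * Df 0 x)\<bar>
          \<le> 4 * (Cf * Cg * w\<^sup>2 * d ^ (2 * m - 1))"
        by (rule abs_diff)
      then show ?thesis unfolding contact by (simp only: mult.assoc)
    qed
    have "norm (Dh 0 b - Dh 0 a) \<le> 4 * Cf * Cg * w\<^sup>2 * d ^ (2 * m - 1) * norm (b - a)"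
    proof (rule field_differentiable_bound[of "{a..b}"])
      fix z assume "z \<in> {a..b}"
      then show "(Dh 0 has_field_derivative Dh 1 z) (at z within {a..b})"
        using Dh(3)[of 0 z] \<open>1 \<le> m\<close> by (simp add: has_field_derivative_at_within)
      show "norm (Dh 1 z) \<le> 4 * Cf * Cg * w\<^sup>2 * d ^ (2 * m - 1)"
        using hb \<open>z \<in> {a..b}\<close> by simp
    qed (use \<open>a < b\<close> in auto)
    moreover have "d ^ (2 * m - 1) * norm (b - a) = d ^ (2 * m)"
      using \<open>1 \<le> m\<close> wd by (cases m) (auto simp: d_def)
    moreover have "w\<^sup>2 = real_modulus \<omega> (b - a) powr (2 * \<alpha>)"
      unfolding w_def power2_eq_square powr_add[symmetric] by simp
    ultimately show "\<bar>\<Gamma> b $ 3 - \<Gamma> a $ 3\<bar>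
        \<le> 4 * Cf * Cg * real_modulus \<omega> (b - a) powr (2 * \<alpha>) * (b - a) ^ (2 * m)"
      using Dh(2) by (simp add: d_def mult.assoc)
  qed
qed

section \<open>A perfect set with dyadic gaps\<close>

definition dyadic_set :: "real set" where
  "dyadic_set = insert 0 (\<Union>n. {(1/2) ^ n .. 3/2 * (1/2) ^ n})"

text \<open>
  The largest power of \<open>2\<close> not exceeding \<open>x > 0\<close>; on \<open>dyadic_set\<close> it is the left endpoint of the
  interval around \<open>x\<close>. The value at \<open>0\<close> is chosen so that the height vanishes there.
\<close>

definition dyadic_floor :: "real \<Rightarrow> real" where
  "dyadic_floor x = (if x \<le> 0 then 0 else 2 powr of_int \<lfloor>log 2 x\<rfloor>)"

lemma dyadic_floor_eq:
  assumes "(1/2) ^ n \<le> x" "x \<le> 3/2 * (1/2) ^ n"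
  shows "dyadic_floor x = (1/2) ^ n"
proof -
  have p: "(1/2::real) ^ n = 2 powr of_int (- int n)"
    by (simp add: powr_minus powr_realpow power_one_over inverse_eq_divide)
  have x: "0 < x" using assms(1) by (rule less_le_trans[rotated]) simp
  have "x < 2 powr (of_int (- int n) + 1)"
    using assms(2) unfolding powr_add p[symmetric] by (rule le_less_trans) simp
  then have "log 2 x < of_int (- int n) + 1"
    using x by (simp add: log_less_iff)
  moreover have "of_int (- int n) \<le> log 2 x"
    using assms(1) x unfolding p by (simp add: le_log_iff)
  ultimately have "\<lfloor>log 2 x\<rfloor> = - int n" by (intro floor_unique) auto
  then show ?thesis using x p by (simp add: dyadic_floor_def)
qed

text \<open>
  The set is the image under multiplication of the product of the compact sets
  \<open>{0} \<union> {2\<^sup>-\<^sup>n | n}\<close> and \<open>[1, 3/2]\<close>.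
\<close>

lemma compact_dyadic_set: "compact dyadic_set"
proof -
  have "compact (insert (0::real) (range (\<lambda>n. (1/2) ^ n)))"
    by (intro compact_sequence_with_limit LIMSEQ_power_zero) simp
  then have "compact ((\<lambda>(x, y). x * y) ` (insert (0::real) (range (\<lambda>n. (1/2) ^ n)) \<times> {1..3/2}))"
    by (intro compact_continuous_image compact_Times)
       (auto intro!: continuous_intros simp: case_prod_unfold)
  also have "(\<lambda>(x, y). x * y) ` (insert (0::real) (range (\<lambda>n. (1/2) ^ n)) \<times> {1..3/2}) = dyadic_set"
    (is "?L = _")
  proof
    show "?L \<subseteq> dyadic_set"
      by (auto simp: dyadic_set_def mult.commute)
    show "dyadic_set \<subseteq> ?L"
    proof
      fix x assume "x \<in> dyadic_set"
      then consider "x = 0" | n where "(1/2) ^ n \<le> x" "x \<le> 3/2 * (1/2) ^ n"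
        by (auto simp: dyadic_set_def)
      then show "x \<in> ?L"
      proof cases
        case 1
        then show ?thesis by (intro image_eqI[of _ _ "(0, 1)"]) auto
      next
        case 2
        then show ?thesis
          by (intro image_eqI[of _ _ "((1/2) ^ n, x * 2 ^ n)"]) (auto simp: field_simps)
      qed
    qed
  qed
  finally show ?thesis .
qed

lemma half_power_in_dyadic_set: "(1/2) ^ n \<in> dyadic_set"
  by (auto simp: dyadic_set_def intro!: exI[of _ n])

lemma zero_limit_of_dyadic_interior: "0 \<in> closure (\<Union>n. {(1/2) ^ n <..< 3/2 * (1/2) ^ n :: real})"
proof -
  have "(\<lambda>n. 5/4 * (1/2) ^ n) \<longlonglongrightarrow> 5/4 * (0::real)"
    by (intro tendsto_intros LIMSEQ_power_zero) simp
  then show ?thesis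
    \<comment> \<open>The sequence runs through the midpoints of the intervals.\<close>
    unfolding closure_sequential
    by (intro exI[of _ "\<lambda>n. 5/4 * (1/2) ^ n"] conjI allI, rule_tac a = n in UN_I) auto
qed

lemma perfect_dyadic_set: "perfect dyadic_set"
proof -
  have "x islimpt dyadic_set" if x: "x \<in> dyadic_set" for x
  proof -
    consider "x = 0" | n where "(1/2) ^ n \<le> x" "x \<le> 3/2 * (1/2) ^ n"
      using x by (auto simp: dyadic_set_def)
    then show ?thesis
    proof cases
      case 1
      have "(\<lambda>n. (1/2) ^ n) \<longlonglongrightarrow> (0::real)" by (intro LIMSEQ_power_zero) simp
      then show ?thesis
        unfolding 1 islimpt_sequential
        by (intro exI[of _ "\<lambda>n. (1/2) ^ n"]) (auto simp: half_power_in_dyadic_set)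
    next
      case 2
      have "(1/2) ^ n < 3/2 * (1/2::real) ^ n" by simp
      then have "x islimpt {(1/2) ^ n .. 3/2 * (1/2) ^ n}"
        using 2 by (intro connected_imp_perfect) auto
      then show ?thesis by (rule islimpt_subset) (auto simp: dyadic_set_def)
    qed
  qed
  moreover have "x \<in> dyadic_set" if "x islimpt dyadic_set" for x
    using that compact_imp_closed[OF compact_dyadic_set] closed_limpt by blast
  ultimately show ?thesis by (auto simp: perfect_def)
qed

lemma dyadic_floor_0 [simp]: "dyadic_floor 0 = 0" by (simp add: dyadic_floor_def)

text \<open>
  If \<open>a\<close> lies in a lower interval than \<open>b\<close> and \<open>s\<close> is the left endpoint of the interval of \<open>b\<close>, then
  \<open>a \<le> 3/2 \<cdot> s/2 = 3/4 \<cdot> s\<close>, so \<open>b - a \<ge> s/4\<close>.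
\<close>

lemma dyadic_floor_gap:
  assumes "a \<in> dyadic_set" "b \<in> dyadic_set" "a < b"
  shows "dyadic_floor a = dyadic_floor b \<or>
    0 \<le> dyadic_floor a \<and> dyadic_floor a \<le> dyadic_floor b \<and> dyadic_floor b \<le> 4 * (b - a)"
proof -
  have "0 \<le> a" using assms(1) by (auto simp: dyadic_set_def intro: order_trans[rotated])
  then obtain k where k: "(1/2) ^ k \<le> b" "b \<le> 3/2 * (1/2) ^ k"
    using assms by (auto simp: dyadic_set_def)
  note fb = dyadic_floor_eq[OF k]
  consider "a = 0" | n where "(1/2) ^ n \<le> a" "a \<le> 3/2 * (1/2) ^ n"
    using assms(1) by (auto simp: dyadic_set_def)
  then show ?thesis
  proof cases
    case 1
    then show ?thesis using k fb assms(3) by simp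
  next
    case 2
    note fa = dyadic_floor_eq[OF 2]
    consider "n = k" | "n < k" | "k < n" by linarith
    then show ?thesis
    proof cases
      case 1
      then show ?thesis using fa fb by simp
    next
      case n: 2
      then have "(1/2::real) ^ k \<le> (1/2) ^ Suc n" by (intro power_decreasing) auto
      then have False using 2 k assms(3) zero_less_power[of "1/2::real" n] by simp
      then show ?thesis ..
    next
      case n: 3
      then have "(1/2::real) ^ n \<le> (1/2) ^ Suc k" by (intro power_decreasing) auto
      then have "(1/2) ^ n \<le> (1/2::real) ^ k" "(1/2) ^ k \<le> 4 * (b - a)"
        using 2 k zero_less_power[of "1/2::real" k] unfolding power_Suc right_diff_distrib by linarith+
      then show ?thesis using fa fb by simp
    qed
  qed
qed

text \<open>
  The order of magnitude of the area discrepancy that the velocity condition tolerates when the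
  projection vanishes; composed with \<open>dyadic_floor\<close> it is the height of the example.
\<close>

definition height_gauge :: "nat \<Rightarrow> (ennreal \<Rightarrow> ennreal) \<Rightarrow> real \<Rightarrow> real" where
  "height_gauge m \<omega> t = real_modulus \<omega> t * t ^ (2 * m)"

lemma height_gauge_nonneg: "0 \<le> t \<Longrightarrow> 0 \<le> height_gauge m \<omega> t"
  by (simp add: height_gauge_def)

lemma height_gauge_mono:
  assumes "modulus_of_continuity \<omega>" "0 \<le> s" "s \<le> t"
  shows "height_gauge m \<omega> s \<le> height_gauge m \<omega> t"
  unfolding height_gauge_def using assms by (intro mult_mono power_mono real_modulus_mono) auto

text \<open>
  A jump is at most the larger of the two heights, which belongs to a scale at most \<open>4 (b - a)\<close>. By
  concavity \<open>\<omega>(4 d) \<le> 4 \<omega>(d)\<close>, whence one factor \<open>4\<close>; the other \<open>2 m\<close> come from the power.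
\<close>

lemma height_gauge_dyadic_floor_diff:
  assumes \<omega>: "modulus_of_continuity \<omega>"
    and ab: "a \<in> dyadic_set" "b \<in> dyadic_set" "a < b"
  shows "\<bar>height_gauge m \<omega> (dyadic_floor b) - height_gauge m \<omega> (dyadic_floor a)\<bar>
    \<le> 4 ^ (2 * m + 1) * height_gauge m \<omega> (b - a)"
  using dyadic_floor_gap[OF ab]
proof
  assume "dyadic_floor a = dyadic_floor b"
  then show ?thesis using ab height_gauge_nonneg[of "b - a" m \<omega>] by simp
next
  assume *: "0 \<le> dyadic_floor a \<and> dyadic_floor a \<le> dyadic_floor b \<and> dyadic_floor b \<le> 4 * (b - a)"
  have "\<bar>height_gauge m \<omega> (dyadic_floor b) - height_gauge m \<omega> (dyadic_floor a)\<bar> \<le> height_gauge m \<omega> (dyadic_floor b)"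
    using * height_gauge_nonneg[of "dyadic_floor a"] height_gauge_mono[OF \<omega>, of "dyadic_floor a" "dyadic_floor b"]
    by simp
  also have "\<dots> \<le> height_gauge m \<omega> (4 * (b - a))"
    using * by (intro height_gauge_mono[OF \<omega>]) auto
  also have "\<dots> \<le> 4 * real_modulus \<omega> (b - a) * (4 * (b - a)) ^ (2 * m)"
  proof -
    have "real_modulus \<omega> (4 * d) \<le> 4 * real_modulus \<omega> d" for d
      using real_modulus_scale[OF \<omega>, of "1/4" "4 * d"] by simp
    from this[of "b - a"] show ?thesis
      unfolding height_gauge_def using ab(3) by (intro mult_right_mono) auto
  qed
  also have "\<dots> = 4 ^ (2 * m + 1) * height_gauge m \<omega> (b - a)"
    unfolding height_gauge_def power_mult_distrib by simp
  finally show ?thesis .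
qed

section \<open>Fields concentrated in the zeroth component\<close>

lemma taylor_zero [simp]: "taylor m (\<lambda>k x. 0) a = (\<lambda>x. 0)"
  by (simp add: taylor_def fun_eq_iff)

lemma area_discrepancy_zero [simp]:
  "area_discrepancy m (\<lambda>k x. 0) (\<lambda>k x. 0) H a b = H 0 b - H 0 a"
  by (simp add: area_discrepancy_def)

lemma velocity1_zero [simp]: "velocity1 m (\<lambda>k x. 0) (\<lambda>k x. 0) a b = (b - a) ^ (2 * m)"
  by (simp add: velocity1_def)

lemma whitney_field_zero: "whitney_field m \<omega> K (\<lambda>k x. 0)"
  by (auto simp: whitney_field_def intro!: exI[of _ 1])

text \<open>
  With all higher components zero, the Taylor polynomials of the field are constants, so only the
  variation of \<open>h\<close> has to be controlled.
\<close>

lemma whitney_field_zeroth_component: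
  assumes \<omega>: "modulus_of_continuity \<omega>" and "0 < C"
    and h: "\<And>a b. a \<in> K \<Longrightarrow> b \<in> K \<Longrightarrow> a < b \<Longrightarrow>
      \<bar>h b - h a\<bar> \<le> C * (real_modulus \<omega> (b - a) * (b - a) ^ m)"
  shows "whitney_field m \<omega> K (\<lambda>k x. if k = 0 then h x else 0)"
  unfolding whitney_field_def
proof (intro exI[of _ C] conjI allI ballI impI)
  fix k a b assume k: "k \<le> m" and ab: "a \<in> K" "b \<in> K"
  let ?H = "\<lambda>(k::nat) x. if k = 0 then h x else 0"
  have est: "\<bar>h b - h a\<bar> \<le> C * (real_modulus \<omega> \<bar>b - a\<bar> * \<bar>b - a\<bar> ^ m)"
    using h[of a b] h[of b a] ab \<open>0 < C\<close>
    by (cases a b rule: linorder_cases) (auto simp: abs_minus_commute)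
  have "taylor (m - k) (\<lambda>l. ?H (k + l)) a b = ?H k a"
  proof -
    have "taylor (m - k) (\<lambda>l. ?H (k + l)) a b
        = (\<Sum>l\<le>m - k. if l = 0 then ?H k a else 0)"
      unfolding taylor_def by (intro sum.cong) auto
    then show ?thesis by simp
  qed
  then have "\<bar>?H k b - taylor (m - k) (\<lambda>l. ?H (k + l)) a b\<bar>
      \<le> C * (real_modulus \<omega> \<bar>b - a\<bar> * \<bar>b - a\<bar> ^ (m - k))"
    using est \<open>0 < C\<close> by (cases "k = 0") auto
  then have "ennreal \<bar>?H k b - taylor (m - k) (\<lambda>l. ?H (k + l)) a b\<bar>
      \<le> ennreal (C * (real_modulus \<omega> \<bar>b - a\<bar> * \<bar>b - a\<bar> ^ (m - k)))"
    by (rule ennreal_leI)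
  then show "ennreal \<bar>?H k b - taylor (m - k) (\<lambda>l. ?H (k + l)) a b\<bar>
      \<le> ennreal C * \<omega> (ennreal \<bar>b - a\<bar>) * ennreal (\<bar>b - a\<bar> ^ (m - k))"
    using \<open>0 < C\<close> by (simp add: ennreal_real_modulus[OF \<omega>] ennreal_mult mult.assoc)
qed (use \<open>0 < C\<close> in simp)

section \<open>The counterexample\<close>

text \<open>
  At \<open>b = 2\<^sup>-\<^sup>n\<close> the prescribed height is \<open>\<omega>(b) b\<^sup>2\<^sup>m\<close>, whereas a horizontal extension, being flat at
  \<open>0\<close>, can only climb to a multiple of \<open>\<omega>(b)\<^sup>2\<^sup>\<alpha> b\<^sup>2\<^sup>m\<close>, which is of smaller order.
\<close>

lemma no_horizontal_extension:
  assumes \<omega>: "modulus_of_continuity \<omega>" and m: "1 \<le> m" and "1/2 < \<alpha>"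
    and hor: "horizontal_curve \<Gamma>"
    and cls: "C_class_curve m (modulus_power \<omega> \<alpha>) UNIV \<Gamma>"
    and ext: "\<And>x. x \<in> dyadic_set \<Longrightarrow> \<Gamma> x = vector [0, 0, height_gauge m \<omega> (dyadic_floor x)]"
  shows False
proof -
  let ?U = "\<Union>n. {(1/2) ^ n <..< 3/2 * (1/2) ^ n :: real}"
  have "?U \<subseteq> dyadic_set" by (auto simp: dyadic_set_def intro: less_imp_le)
  then have zero: "\<Gamma> x $ 1 = 0 \<and> \<Gamma> x $ 2 = 0" if "x \<in> ?U" for x
  proof -
    have "x \<in> dyadic_set" using that \<open>?U \<subseteq> dyadic_set\<close> by blast
    then show ?thesis using ext by (simp add: vector_3)
  qed
  obtain C where C: "0 \<le> C" "\<And>b. 0 < b \<Longrightarrow>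
      \<bar>\<Gamma> b $ 3 - \<Gamma> 0 $ 3\<bar> \<le> C * real_modulus \<omega> (b - 0) powr (2 * \<alpha>) * (b - 0) ^ (2 * m)"
    by (rule horizontal_flat_height_bound[OF \<omega> m _ hor cls, of ?U 0])
       (use zero zero_limit_of_dyadic_interior \<open>1/2 < \<alpha>\<close> in auto)
  have "1 \<le> C * real_modulus \<omega> ((1/2) ^ n) powr (2 * \<alpha> - 1)" for n
  proof -
    define b :: real where "b = (1/2) ^ n"
    have b: "0 < b" by (simp add: b_def)
    define w where "w = real_modulus \<omega> b"
    have w: "0 < w" unfolding w_def using b by (rule real_modulus_pos[OF \<omega>])
    have "\<Gamma> b $ 3 = w * b ^ (2 * m)"
      using ext[OF half_power_in_dyadic_set[of n]] dyadic_floor_eq[of n b]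
      by (simp add: height_gauge_def w_def b_def vector_3)
    moreover have "\<Gamma> 0 $ 3 = 0"
      using ext[of 0] m by (simp add: height_gauge_def dyadic_set_def vector_3)
    ultimately have "w * b ^ (2 * m) \<le> C * w powr (2 * \<alpha>) * b ^ (2 * m)"
      using C(2)[OF b] w b by (simp add: w_def)
    then have "w \<le> C * w powr (2 * \<alpha>)" using b by simp
    also have "w powr (2 * \<alpha>) = w powr (2 * \<alpha> - 1) * w"
      using w by (simp add: powr_diff)
    finally have "1 * w \<le> (C * w powr (2 * \<alpha> - 1)) * w" by (simp add: mult.assoc)
    then show ?thesis using w unfolding w_def b_def by (metis mult_le_cancel_right_pos)
  qed
  moreover have "(\<lambda>n. C * real_modulus \<omega> ((1/2) ^ n) powr (2 * \<alpha> - 1)) \<longlonglongrightarrow> C * 0"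
  proof (intro tendsto_intros)
    have "(\<lambda>n. real_modulus \<omega> ((1/2) ^ n)) \<longlonglongrightarrow> 0"
      by (intro real_modulus_tendsto_0[OF \<omega>] LIMSEQ_power_zero) simp
    then show "(\<lambda>n. real_modulus \<omega> ((1/2) ^ n) powr (2 * \<alpha> - 1)) \<longlonglongrightarrow> 0"
      using \<open>1/2 < \<alpha>\<close> by (intro tendsto_zero_powrI[of _ _ _ "2 * \<alpha> - 1"]) auto
  qed
  ultimately have "1 \<le> C * 0" by (intro LIMSEQ_le_const) auto
  then show False by simp
qed

theorem theorem1p2:
  fixes m :: nat and \<omega> :: "ennreal \<Rightarrow> ennreal"
  assumes "m \<ge> 1" and "modulus_of_continuity \<omega>"
  shows "\<exists>(K :: real set) (C :: real) (F :: nat \<Rightarrow> real \<Rightarrow> real)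
            (G :: nat \<Rightarrow> real \<Rightarrow> real) (H :: nat \<Rightarrow> real \<Rightarrow> real).
     compact K \<and> perfect K \<and> C > 0 \<and>
     (\<forall>k\<le>m. continuous_on K (F k) \<and> continuous_on K (G k) \<and> continuous_on K (H k)) \<and>
     whitney_field m \<omega> K F \<and> whitney_field m \<omega> K G \<and> whitney_field m \<omega> K H \<and>
     (\<forall>k\<in>{1..m}. \<forall>x\<in>K.
        H k x = 2 * (\<Sum>i=0..k-1. real ((k - 1) choose i) * (F (k - i) x * G i x - G (k - i) x * F i x))) \<and>
     (\<forall>a\<in>K. \<forall>b\<in>K. a < b \<longrightarrow>
        ennreal \<bar>area_discrepancy m F G H a b / velocity1 m F G a b\<bar>
          \<le> ennreal C * \<omega> (ennreal (b - a))) \<and>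
     (\<forall>\<alpha>\<in>{1/2<..1::real}.
        \<not> (\<exists>\<Gamma> :: real \<Rightarrow> real^3.
              horizontal_curve \<Gamma> \<and> C_class_curve m (modulus_power \<omega> \<alpha>) UNIV \<Gamma> \<and>
              (\<forall>x\<in>K. \<Gamma> x = vector [F 0 x, G 0 x, H 0 x])))"
proof -
  note \<omega> = \<open>modulus_of_continuity \<omega>\<close>
  define h where "h x = height_gauge m \<omega> (dyadic_floor x)" for x
  define C :: real where "C = 4 ^ (2 * m + 1)"
  define Z :: "nat \<Rightarrow> real \<Rightarrow> real" where "Z = (\<lambda>k x. 0)"
  define H where "H = (\<lambda>(k::nat) x. if k = 0 then h x else 0)"
  have C: "0 < C" by (simp add: C_def)
  have diff: "\<bar>h b - h a\<bar> \<le> C * (real_modulus \<omega> (b - a) * (b - a) ^ (2 * m))"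
    if "a \<in> dyadic_set" "b \<in> dyadic_set" "a < b" for a b
    using height_gauge_dyadic_floor_diff[OF \<omega> that, of m] by (simp add: h_def C_def height_gauge_def)
  have range: "0 \<le> x \<and> x \<le> 2" if "x \<in> dyadic_set" for x
  proof -
    have "x \<le> 3/2 * (1/2) ^ n \<Longrightarrow> x \<le> 2" "(1/2) ^ n \<le> x \<Longrightarrow> 0 \<le> x" for n
      using power_le_one[of "1/2::real" n] zero_le_power[of "1/2::real" n] by linarith+
    then show ?thesis using that by (auto simp: dyadic_set_def)
  qed
  have diff': "\<bar>h b - h a\<bar> \<le> C * 2 ^ m * (real_modulus \<omega> (b - a) * (b - a) ^ m)"
    if ab: "a \<in> dyadic_set" "b \<in> dyadic_set" "a < b" for a b
  proof -
    have "(b - a) ^ m \<le> 2 ^ m" using range[OF ab(1)] range[OF ab(2)] ab(3) by (intro power_mono) auto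
    then have "(b - a) ^ (2 * m) \<le> 2 ^ m * (b - a) ^ m"
      using ab(3) by (simp add: mult_2 power_add mult_right_mono)
    then have "C * (real_modulus \<omega> (b - a) * (b - a) ^ (2 * m))
        \<le> C * (real_modulus \<omega> (b - a) * (2 ^ m * (b - a) ^ m))"
      using C by (intro mult_left_mono) auto
    then show ?thesis using diff[OF ab] by (simp add: mult_ac)
  qed
  \<comment> \<open>As \<open>2 m \<ge> 1\<close>, the variation estimate implies that \<open>h\<close> is Lipschitz on the bounded set.\<close>
  have cont: "continuous_on dyadic_set h"
  proof (rule lipschitz_on_continuous_on[OF lipschitz_onI])
    let ?L = "C * real_modulus \<omega> 2 * 2 ^ (2 * m)"
    show "0 \<le> ?L" using C by simp
    fix a b assume ab: "a \<in> dyadic_set" "b \<in> dyadic_set"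
    have le: "\<bar>h b - h a\<bar> \<le> ?L * (b - a)" if ab: "a \<in> dyadic_set" "b \<in> dyadic_set" "a < b" for a b
    proof -
      have d: "0 < b - a" "b - a \<le> 2" using range[OF ab(1)] range[OF ab(2)] ab(3) by auto
      have "2 * m = Suc (2 * m - 1)" using \<open>m \<ge> 1\<close> by simp
      then have "(b - a) ^ (2 * m) = (b - a) ^ (2 * m - 1) * (b - a)"
        by (metis power_Suc2)
      also have "\<dots> \<le> 2 ^ (2 * m - 1) * (b - a)"
        using d by (intro mult_right_mono power_mono) auto
      also have "\<dots> \<le> 2 ^ (2 * m) * (b - a)"
        using d by (intro mult_right_mono power_increasing) auto
      finally have "real_modulus \<omega> (b - a) * (b - a) ^ (2 * m)
          \<le> real_modulus \<omega> 2 * (2 ^ (2 * m) * (b - a))"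
        using d by (intro mult_mono real_modulus_mono[OF \<omega>]) auto
      then have "C * (real_modulus \<omega> (b - a) * (b - a) ^ (2 * m)) \<le> ?L * (b - a)"
        using C by (simp add: mult.assoc)
      then show ?thesis using diff[OF ab] by linarith
    qed
    show "dist (h a) (h b) \<le> ?L * dist a b"
      using le[of a b] le[of b a] ab
      by (cases a b rule: linorder_cases) (auto simp: dist_real_def abs_minus_commute)
  qed
  show ?thesis
  proof (rule exI[of _ dyadic_set], rule exI[of _ C], rule exI[of _ Z], rule exI[of _ Z],
      rule exI[of _ H], intro conjI)
    show "whitney_field m \<omega> dyadic_set H"
      unfolding H_def using diff' C
      by (intro whitney_field_zeroth_component[OF \<omega>, of "C * 2 ^ m"]) auto
    show "\<forall>a\<in>dyadic_set. \<forall>b\<in>dyadic_set. a < b \<longrightarrow>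
        ennreal \<bar>area_discrepancy m Z Z H a b / velocity1 m Z Z a b\<bar>
          \<le> ennreal C * \<omega> (ennreal (b - a))"
    proof (intro ballI impI)
      fix a b assume ab: "a \<in> dyadic_set" "b \<in> dyadic_set" "a < b"
      have "\<bar>(h b - h a) / (b - a) ^ (2 * m)\<bar> \<le> C * real_modulus \<omega> (b - a)"
        using diff[OF ab] ab(3) by (simp add: abs_divide pos_divide_le_eq mult.assoc)
      then show "ennreal \<bar>area_discrepancy m Z Z H a b / velocity1 m Z Z a b\<bar>
          \<le> ennreal C * \<omega> (ennreal (b - a))"
        using C unfolding Z_def H_def
        by (simp add: ennreal_real_modulus[OF \<omega>] ennreal_leI flip: ennreal_mult)
    qed
    show "\<forall>\<alpha>\<in>{1/2<..1::real}.
        \<not> (\<exists>\<Gamma> :: real \<Rightarrow> real^3.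
              horizontal_curve \<Gamma> \<and> C_class_curve m (modulus_power \<omega> \<alpha>) UNIV \<Gamma> \<and>
              (\<forall>x\<in>dyadic_set. \<Gamma> x = vector [Z 0 x, Z 0 x, H 0 x]))"
    proof (intro ballI notI, elim exE conjE)
      fix \<alpha> :: real and \<Gamma>
      assume "\<alpha> \<in> {1/2<..1}" "horizontal_curve \<Gamma>"
        "C_class_curve m (modulus_power \<omega> \<alpha>) UNIV \<Gamma>"
        "\<forall>x\<in>dyadic_set. \<Gamma> x = vector [Z 0 x, Z 0 x, H 0 x]"
      then show False
        by (intro no_horizontal_extension[OF \<omega> assms(1), of \<alpha> \<Gamma>]) (simp_all add: Z_def H_def h_def)
    qed
    show "\<forall>k\<le>m. continuous_on dyadic_set (Z k) \<and> continuous_on dyadic_set (Z k)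
        \<and> continuous_on dyadic_set (H k)"
    proof (intro allI impI conjI)
      show "continuous_on dyadic_set (H k)" for k
        using cont by (cases "k = 0") (simp_all add: H_def)
    qed (simp_all add: Z_def)
  qed (use C compact_dyadic_set perfect_dyadic_set whitney_field_zero in
      \<open>auto simp: Z_def H_def\<close>)
qed

end
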